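(* Let $L \ge 1$ and let $A \in \{0,1\}^{L\times L}$ be the adjacency matrix of a directed graph $G$ on the nodes $1,\dots,L$ (so $A_{ij}=1$ if and only if there is a directed edge from $i$ to $j$). Then $G$ is a directed acyclic graph (DAG) if and only if there exist a vector $\xi \in \mathbb{R}^L$ and nonnegative real numbers $B_{ij} \ge 0$ ($1 \le i,j \le L$) such that $$A = \lim_{\beta \to 0^+} E, \qquad \text{where } E = E(\beta) \text{ has entries } \; E_{ij} = \mathrm{ReLU}\left(\tanh\left(\frac{1}{\beta}\, B_{ij}(\xi_j - \xi_i)\right)\right), \quad \beta>0,$$ with the limit taken entrywise.
   Context: $\mathrm{ReLU}(x) = \max(x,0)$ for $x \in \mathbb{R}$. The numbers $\xi_\ell$ are node scores, the $B_{ij}$ are nonnegative edge weights, and $\beta > 0$ is a scalar temperature parameter. A directed graph is a DAG if it contains no directed cycle (in particular no self-loop). *)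

theory Defs
  imports "HOL-Analysis.Analysis" "Graph_Theory.Pair_Digraph"
begin

text \<open>
  The nodes \<open>1, \<dots>, L\<close> are rendered as the elements of a finite type \<open>'n\<close>, with
  \<open>L = CARD('n) \<ge> 1\<close>. A digraph without parallel arcs is a \<open>pair_pre_digraph\<close>, whose arcs are
  the pairs \<open>(i, j)\<close> for edges from \<open>i\<close> to \<open>j\<close>; self-loops \<open>(i, i)\<close> are permitted.
\<close>

definition is_adjacency_matrix :: "real ^ 'n ^ 'n \<Rightarrow> 'n::finite pair_pre_digraph \<Rightarrow> bool" where
  "is_adjacency_matrix A G \<longleftrightarrow>
     (\<forall>i j. A $ i $ j \<in> {0, 1}) \<and> (\<forall>i j. A $ i $ j = 1 \<longleftrightarrow> (i, j) \<in> parcs G)"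

text \<open>A cycle in the sense of \<open>Graph_Theory\<close> is a nonempty closed walk with no repeated node
  other than its endpoint; a self-loop is a cycle of length 1.\<close>

definition dag :: "'a pair_pre_digraph \<Rightarrow> bool" where
  "dag G \<longleftrightarrow> (\<nexists>p. pre_digraph.cycle (with_proj G) p)"

definition ReLU :: "real \<Rightarrow> real" where
  "ReLU x = max x 0"

definition edge_matrix :: "real ^ 'n ^ 'n \<Rightarrow> real ^ 'n \<Rightarrow> real \<Rightarrow> real ^ 'n ^ 'n::finite" where
  "edge_matrix B \<xi> \<beta> = (\<chi> i j. ReLU (tanh (1 / \<beta> * (B $ i $ j * (\<xi> $ j - \<xi> $ i)))))"

end

theory Submission
  imports Defs
begin

text \<open>
  As \<open>\<beta>\<close> decreases to 0, the \<open>(i, j)\<close> entry tends to 1 if \<open>B\<^sub>i\<^sub>j (\<xi>\<^sub>j - \<xi>\<^sub>i) > 0\<close> and to 0 otherwise.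
  So every arc of a limit graph strictly increases \<open>\<xi>\<close>, which rules out cycles. Conversely, an
  acyclic graph is recovered from \<open>B = A\<close> with the number of proper ancestors of a node as its
  score.
\<close>

text \<open>For \<open>c > 0\<close> the argument tends to infinity, where \<open>tanh\<close> tends
  to 1. For \<open>c \<le> 0\<close> the argument is nonpositive for every \<beta> > 0, so
  \<open>ReLU\<close> clips the value to exactly 0.\<close>

lemma tendsto_ReLU_tanh:
  "((\<lambda>\<beta>. ReLU (tanh (1 / \<beta> * c))) \<longlongrightarrow> (if c > 0 then 1 else 0)) (at_right 0)"
proof (cases "c > 0")
  case True
  have "LIM \<beta> at_right 0. c * inverse \<beta> :> at_top"
    using True filterlim_inverse_at_top_right
    by (intro filterlim_tendsto_pos_mult_at_top[OF tendsto_const])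
  then have "((\<lambda>\<beta>. tanh (c * inverse \<beta>)) \<longlongrightarrow> 1) (at_right 0)"
    by (rule filterlim_compose[OF tanh_real_at_top])
  then have "((\<lambda>\<beta>. max (tanh (c * inverse \<beta>)) 0) \<longlongrightarrow> max 1 0) (at_right 0)"
    by (intro tendsto_max tendsto_const)
  then show ?thesis
    using True by (simp add: ReLU_def field_simps)
next
  case False
  have "\<forall>\<^sub>F \<beta> in at_right 0. ReLU (tanh (1 / \<beta> * c)) = 0"
    unfolding eventually_at_right_field ReLU_def
    using False by (auto intro!: exI[of _ 1] divide_nonpos_pos max_absorb2)
  then show ?thesis
    using False by (simp add: tendsto_eventually)
qed

lemma tendsto_edge_matrix:
  "((\<lambda>\<beta>. edge_matrix B \<xi> \<beta> $ i $ j) \<longlongrightarrow>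
     (if B $ i $ j * (\<xi> $ j - \<xi> $ i) > 0 then 1 else 0)) (at_right 0)"
  unfolding edge_matrix_def using tendsto_ReLU_tanh by simp

text \<open>Uniqueness of limits turns convergence into an equation, so that the main proof is
  purely combinatorial.\<close>

lemma edge_matrix_tendsto_iff:
  "((\<lambda>\<beta>. edge_matrix B \<xi> \<beta> $ i $ j) \<longlongrightarrow> a) (at_right 0) \<longleftrightarrow>
     a = (if B $ i $ j * (\<xi> $ j - \<xi> $ i) > 0 then 1 else 0)"
  using tendsto_edge_matrix[of B \<xi> i j] tendsto_unique[OF trivial_limit_at_right_real] by blast

text \<open>Every nonempty closed walk contains a cycle, and such walks at \<open>u\<close> exist
  exactly when \<open>u\<close> reaches itself in the transitive closure.\<close>

lemma (in pair_wf_digraph) dag_iff_acyclic: "dag G \<longleftrightarrow> acyclic (parcs G)"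
proof -
  have "(\<exists>p. cycle p) \<longleftrightarrow> (\<exists>p. closed_w p)"
    using closed_w_imp_cycle by (auto simp: cycle_altdef)
  also have "\<dots> \<longleftrightarrow> (\<exists>u. (u, u) \<in> (parcs G)\<^sup>+)"
    using reachable1_awalk by (auto simp: closed_w_def)
  finally show ?thesis
    by (simp add: dag_def acyclic_def)
qed

lemma acyclic_imp_strict_potential:
  fixes r :: "'a::finite rel"
  assumes "acyclic r"
  shows "\<exists>f :: 'a \<Rightarrow> nat. \<forall>(x, y) \<in> r. f x < f y"
proof -
  have "card {k. (k, x) \<in> r\<^sup>+} < card {k. (k, y) \<in> r\<^sup>+}" if "(x, y) \<in> r" for x y
  proof (rule psubset_card_mono)
    \<comment> \<open>The node \<open>x\<close> makes the inclusion strict: the arc puts it among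
      the ancestors of \<open>y\<close>, and acyclicity keeps it out of its own.\<close>
    have "x \<in> {k. (k, y) \<in> r\<^sup>+}" "x \<notin> {k. (k, x) \<in> r\<^sup>+}"
      using that assms by (auto simp: acyclic_def)
    moreover have "{k. (k, x) \<in> r\<^sup>+} \<subseteq> {k. (k, y) \<in> r\<^sup>+}"
      using that by (auto intro: trancl_into_trancl)
    ultimately show "{k. (k, x) \<in> r\<^sup>+} \<subset> {k. (k, y) \<in> r\<^sup>+}"
      by blast
  qed simp
  then show ?thesis
    by (intro exI[of _ "\<lambda>x. card {k. (k, x) \<in> r\<^sup>+}"]) blast
qed

lemma strict_potential_imp_acyclic:
  fixes f :: "'a \<Rightarrow> 'b::preorder"
  assumes "\<And>x y. (x, y) \<in> r \<Longrightarrow> f x < f y"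
  shows "acyclic r"
proof -
  have "f x < f y" if "(x, y) \<in> r\<^sup>+" for x y
    using that by induction (auto intro: assms less_trans)
  then show ?thesis
    by (auto simp: acyclic_def)
qed

theorem theorem2p1:
  fixes G :: "'n::finite pair_pre_digraph" and A :: "real ^ 'n ^ 'n"
  assumes "pair_wf_digraph G" and "pverts G = UNIV" and "is_adjacency_matrix A G"
  shows "dag G \<longleftrightarrow>
    (\<exists>(\<xi> :: real ^ 'n) (B :: real ^ 'n ^ 'n).
       (\<forall>i j. B $ i $ j \<ge> 0) \<and>
       (\<forall>i j. ((\<lambda>\<beta>. edge_matrix B \<xi> \<beta> $ i $ j) \<longlongrightarrow> A $ i $ j) (at_right 0)))"
    (is "_ \<longleftrightarrow> ?rhs")
proof -
  have A: "A $ i $ j = (if (i, j) \<in> parcs G then 1 else 0)" for i j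
    using assms(3) by (auto simp: is_adjacency_matrix_def)
  have "?rhs" if acyc: "acyclic (parcs G)"
  proof -
    obtain f :: "'n \<Rightarrow> nat" where f: "\<forall>(i, j) \<in> parcs G. f i < f j"
      using acyclic_imp_strict_potential[OF acyc] by blast
    show ?thesis
      \<comment> \<open>On an arc the weight is 1 and the score difference positive; off the arcs
        the weight 0 cancels a difference of either sign.\<close>
      using f by (intro exI[of _ "\<chi> i. real (f i)"] exI[of _ A])
        (auto simp: edge_matrix_tendsto_iff A)
  qed
  moreover have "acyclic (parcs G)" if rhs: ?rhs
  proof -
    obtain \<xi> :: "real ^ 'n" and B :: "real ^ 'n ^ 'n" where B: "\<And>i j. B $ i $ j \<ge> 0"
      and lim: "\<And>i j. A $ i $ j = (if B $ i $ j * (\<xi> $ j - \<xi> $ i) > 0 then 1 else 0)"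
      using rhs unfolding edge_matrix_tendsto_iff by blast
    have "\<xi> $ i < \<xi> $ j" if "(i, j) \<in> parcs G" for i j
    proof -
      have "B $ i $ j * (\<xi> $ j - \<xi> $ i) > 0"
        using that lim[of i j] A[of i j] by (auto split: if_splits)
      then show ?thesis
        \<comment> \<open>Nonnegativity of \<open>B\<close> excludes the case of two negative
          factors.\<close>
        using B[of i j] by (auto simp: zero_less_mult_iff)
    qed
    then show ?thesis
      by (rule strict_potential_imp_acyclic)
  qed
  ultimately show ?thesis
    using pair_wf_digraph.dag_iff_acyclic[OF assms(1)] by blast
qed

end
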